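(* Let $A\in\mathbb{R}^{n\times n}$, $B\in\mathbb{R}^{n\times m}$ with $(A,B)$ controllable and $B$ of full column rank, let $T>0$, and let $G(t)$, $\tilde A,\tilde B,\bar H,\bar N,\bar f$ be as in the context. There exists a solution (a constant $Q\in\mathbb{R}^{n\times n}$ together with a function $Y:[0,T]\to\mathbb{R}^{n\times n}$) of $$\mathrm{vec}(\dot Y)=\tilde A^T\mathrm{vec}(Y)-\mathrm{vec}(Q)-\mathrm{vec}(G),\qquad \tilde B^T\mathrm{vec}(Y)=0\qquad (t\in[0,T])$$ if and only if there exists $q_v\in\mathbb{R}^{n^2}$ satisfying, on $[0,T]$, $$(\bar H\tilde A^T\bar H^{-1}\bar N+\bar H)\,q_v=-\bar H\tilde A^T\bar H^{-1}\bar f(\mathrm{vec}(G))+\dot{\bar f}(\mathrm{vec}(G))-\bar H\,\mathrm{vec}(G).$$ Then the unique $\mathrm{vec}(Y)$ for a feasible $\mathrm{vec}(Q)=q_v$ is given by $$\bar H\,\mathrm{vec}(Y)+\bar N\,\mathrm{vec}(Q)+\bar f(\mathrm{vec}(G))=0 .$$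
   Context: $\otimes$ is the Kronecker product, $\mathrm{vec}$ stacks columns, $X^\dagger$ is the Moore-Penrose inverse. Data: $K(t)\in\mathbb{R}^{m\times n}$, $t\in[0,T]$, is a given (observed) feedback matrix, $P_0(t)=-K^T(t)(K(t)B)^\dagger K(t)$ and $G(t)=\dot P_0+A^TP_0+P_0A-P_0BB^TP_0$. Notation: $\tilde A=-I_n\otimes A-A\otimes I_n$, $\tilde B=I_n\otimes B$; $$H=\begin{bmatrix}\tilde B^T\\ \tilde B^T\tilde A^T\\ \vdots\\ \tilde B^T(\tilde A^T)^{n-1}\end{bmatrix}\in\mathbb{R}^{n^2m\times n^2},\qquad N=\begin{bmatrix}0\\ -\tilde B^T\\ -\tilde B^T\tilde A^T\\ \vdots\\ -\tilde B^T(\tilde A^T)^{n-2}\end{bmatrix},$$ and $f(\mathrm{vec}(G))$ is the time-dependent vector with $n$ blocks whose block number $k$ ($k=0,\dots,n-1$) is $-\sum_{i=0}^{k-1}\tilde B^T(\tilde A^T)^{k-1-i}\mathrm{vec}(G^{(i)})$ (block $0$ is zero), $G^{(i)}$ denoting the $i$-th time derivative of $G$. Since $(A,B)$ is controllable, $H$ has full column rank. Choose $n^2$ linearly independent rows of $H$; they form a square matrix $\bar H\in\mathbb{R}^{n^2\times n^2}$, and $\bar N$, $\bar f(\mathrm{vec}(G))$ consist of the corresponding rows of $N$ and $f(\mathrm{vec}(G))$. $\dot{\bar f}(\mathrm{vec}(G))$ is the time derivative of $\bar f(\mathrm{vec}(G))$.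
   Formalization: The "if" direction and the formula for every q_v solving the equation are stated for choices of n² independent rows of H that include all rows of the top block B̃ᵀ (shown to exist); they fail for other choices, where "only if" and the formula for solvable Q are kept. *)

theory Defs
  imports "HOL-Analysis.Analysis"
begin

text \<open>
  The dimensions are \<open>n = CARD('n)\<close> and \<open>m = CARD('m)\<close>. Vectors in \<open>\<real>^(n\<^sup>2)\<close> are indexed by
  pairs \<open>'n \<times> 'n\<close>, whose first component is the block number and whose second component is the
  position inside the block; Kronecker products use the same convention.
\<close>

definition kron :: "real^'b^'a \<Rightarrow> real^'d^'c \<Rightarrow> real^('b \<times> 'd)^('a \<times> 'c)" where
  "kron M N = (\<chi> p q. M $ fst p $ fst q * N $ snd p $ snd q)"

text \<open>Block \<open>j\<close> of \<open>vecc X\<close> is the \<open>j\<close>-th column of \<open>X\<close>. (The library's \<open>vec\<close> is the constant vector.)\<close>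

definition vecc :: "real^'b^'a \<Rightarrow> real^('b \<times> 'a)" where
  "vecc X = (\<chi> p. X $ snd p $ fst p)"

primrec mat_pow :: "real^'a^'a \<Rightarrow> nat \<Rightarrow> real^'a^'a" where
  "mat_pow M 0 = mat 1"
| "mat_pow M (Suc k) = M ** mat_pow M k"

definition mp_inverse :: "real^'b^'a \<Rightarrow> real^'a^'b" where
  "mp_inverse M = (THE X. M ** X ** M = M \<and> X ** M ** X = X \<and>
     transpose (M ** X) = M ** X \<and> transpose (X ** M) = X ** M)"

text \<open>Every state can be steered to every other state in finite time by the system \<open>x' = A x + B u\<close>.\<close>

definition controllable :: "real^'n^'n \<Rightarrow> real^'m^'n \<Rightarrow> bool" where
  "controllable A B \<longleftrightarrow>
     (\<forall>x0 x1. \<exists>\<tau>>0. \<exists>(u :: real \<Rightarrow> real^'m) (x :: real \<Rightarrow> real^'n).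
        continuous_on {0..\<tau>} u \<and>
        (\<forall>t\<in>{0..\<tau>}. (x has_vector_derivative (A *v x t + B *v u t)) (at t within {0..\<tau>})) \<and>
        x 0 = x0 \<and> x \<tau> = x1)"

text \<open>Time derivatives are taken on \<open>[0,T]\<close>, hence one-sided at the end points.\<close>

definition tderiv :: "real \<Rightarrow> (real \<Rightarrow> 'v::real_normed_vector) \<Rightarrow> real \<Rightarrow> 'v" where
  "tderiv T F t = vector_derivative F (at t within {0..T})"

definition tdifferentiable :: "real \<Rightarrow> (real \<Rightarrow> 'v::real_normed_vector) \<Rightarrow> bool" where
  "tdifferentiable T F \<longleftrightarrow> (\<forall>t\<in>{0..T}. F differentiable (at t within {0..T}))"

definition times_tdifferentiable ::
    "nat \<Rightarrow> real \<Rightarrow> (real \<Rightarrow> 'v::real_normed_vector) \<Rightarrow> bool" where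
  "times_tdifferentiable k T F \<longleftrightarrow> (\<forall>i<k. tdifferentiable T ((tderiv T ^^ i) F))"

definition P0 :: "real^'m^'n \<Rightarrow> (real \<Rightarrow> real^'n^'m) \<Rightarrow> real \<Rightarrow> real^'n^'n" where
  "P0 B K t = - (transpose (K t) ** mp_inverse (K t ** B) ** K t)"

definition G_of ::
    "real \<Rightarrow> real^'n^'n \<Rightarrow> real^'m^'n \<Rightarrow> (real \<Rightarrow> real^'n^'m) \<Rightarrow> real \<Rightarrow> real^'n^'n" where
  "G_of T A B K t = tderiv T (P0 B K) t + transpose A ** P0 B K t + P0 B K t ** A
     - P0 B K t ** B ** transpose B ** P0 B K t"

definition A_til :: "real^'n^'n \<Rightarrow> real^('n \<times> 'n)^('n \<times> 'n)" where
  "A_til A = - kron (mat 1) A - kron A (mat 1)"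

definition B_til :: "real^'m^'n \<Rightarrow> real^('n \<times> 'm)^('n \<times> 'n)" where
  "B_til B = kron (mat 1) B"

text \<open>
  Block number \<open>k\<close> of \<open>H\<close>, \<open>N\<close> and \<open>f(vec(G))\<close>; the stacked objects consist of the blocks
  \<open>k < n\<close>. A row of the stacked objects is addressed by a pair \<open>(k, r)\<close>, where \<open>r\<close> is the row
  inside block \<open>k\<close>.
\<close>

definition H_block ::
    "real^'n^'n \<Rightarrow> real^'m^'n \<Rightarrow> nat \<Rightarrow> real^('n \<times> 'n)^('n \<times> 'm)" where
  "H_block A B k = transpose (B_til B) ** mat_pow (transpose (A_til A)) k"

definition N_block ::
    "real^'n^'n \<Rightarrow> real^'m^'n \<Rightarrow> nat \<Rightarrow> real^('n \<times> 'n)^('n \<times> 'm)" where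
  "N_block A B k =
     (if k = 0 then 0 else - (transpose (B_til B) ** mat_pow (transpose (A_til A)) (k - 1)))"

definition f_block ::
    "real \<Rightarrow> real^'n^'n \<Rightarrow> real^'m^'n \<Rightarrow> (real \<Rightarrow> real^'n^'n) \<Rightarrow> nat \<Rightarrow> real \<Rightarrow> real^('n \<times> 'm)" where
  "f_block T A B G k t =
     - (\<Sum>i<k. (transpose (B_til B) ** mat_pow (transpose (A_til A)) (k - 1 - i))
                 *v vecc ((tderiv T ^^ i) G t))"

definition H_row :: "real^'n^'n \<Rightarrow> real^'m^'n \<Rightarrow> nat \<times> ('n \<times> 'm) \<Rightarrow> real^('n \<times> 'n)" where
  "H_row A B s = H_block A B (fst s) $ snd s"

text \<open>A choice \<open>\<sigma>\<close> of \<open>n\<^sup>2\<close> linearly independent rows of \<open>H\<close>, labelled by \<open>'n \<times> 'n\<close>.\<close>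

definition row_choice ::
    "real^'n^'n \<Rightarrow> real^'m^'n \<Rightarrow> ('n \<times> 'n \<Rightarrow> nat \<times> ('n \<times> 'm)) \<Rightarrow> bool" where
  "row_choice A B \<sigma> \<longleftrightarrow> (\<forall>p. fst (\<sigma> p) < CARD('n)) \<and>
     inj (\<lambda>p. H_row A B (\<sigma> p)) \<and> independent (range (\<lambda>p. H_row A B (\<sigma> p)))"

text \<open>
  All rows of the top block \<open>transpose (B_til B)\<close> of \<open>H\<close> are among the chosen ones. Without this
  the solvability of the equation for \<open>q\<^sub>v\<close> is only necessary: for \<open>n = m = 3\<close>, \<open>A = B = I\<close>
  and the third block of \<open>H\<close> as \<open>H_bar\<close>, that equation reduces to \<open>G'' = 0\<close>,
  whereas the constrained differential equation forces \<open>Y = 0\<close> and hence \<open>G\<close> constant.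
\<close>

definition contains_top_block :: "('n \<times> 'n \<Rightarrow> nat \<times> ('n \<times> 'm)) \<Rightarrow> bool" where
  "contains_top_block \<sigma> \<longleftrightarrow> (\<forall>r. (0, r) \<in> range \<sigma>)"

definition H_bar ::
    "real^'n^'n \<Rightarrow> real^'m^'n \<Rightarrow> ('n \<times> 'n \<Rightarrow> nat \<times> ('n \<times> 'm)) \<Rightarrow> real^('n \<times> 'n)^('n \<times> 'n)" where
  "H_bar A B \<sigma> = (\<chi> p. H_row A B (\<sigma> p))"

definition N_bar ::
    "real^'n^'n \<Rightarrow> real^'m^'n \<Rightarrow> ('n \<times> 'n \<Rightarrow> nat \<times> ('n \<times> 'm)) \<Rightarrow> real^('n \<times> 'n)^('n \<times> 'n)" where
  "N_bar A B \<sigma> = (\<chi> p. N_block A B (fst (\<sigma> p)) $ snd (\<sigma> p))"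

definition f_bar ::
    "real \<Rightarrow> real^'n^'n \<Rightarrow> real^'m^'n \<Rightarrow> ('n \<times> 'n \<Rightarrow> nat \<times> ('n \<times> 'm)) \<Rightarrow>
     (real \<Rightarrow> real^'n^'n) \<Rightarrow> real \<Rightarrow> real^('n \<times> 'n)" where
  "f_bar T A B \<sigma> G t = (\<chi> p. f_block T A B G (fst (\<sigma> p)) t $ snd (\<sigma> p))"

definition is_solution ::
    "real \<Rightarrow> real^'n^'n \<Rightarrow> real^'m^'n \<Rightarrow> (real \<Rightarrow> real^'n^'n) \<Rightarrow>
     real^'n^'n \<Rightarrow> (real \<Rightarrow> real^'n^'n) \<Rightarrow> bool" where
  "is_solution T A B G Q Y \<longleftrightarrow> tdifferentiable T Y \<and>
     (\<forall>t\<in>{0..T}.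
        vecc (tderiv T Y t) = transpose (A_til A) *v vecc (Y t) - vecc Q - vecc (G t) \<and>
        transpose (B_til B) *v vecc (Y t) = 0)"

definition q_equation ::
    "real \<Rightarrow> real^'n^'n \<Rightarrow> real^'m^'n \<Rightarrow> ('n \<times> 'n \<Rightarrow> nat \<times> ('n \<times> 'm)) \<Rightarrow>
     (real \<Rightarrow> real^'n^'n) \<Rightarrow> real^('n \<times> 'n) \<Rightarrow> bool" where
  "q_equation T A B \<sigma> G q \<longleftrightarrow>
     (let Hb = H_bar A B \<sigma>; Nb = N_bar A B \<sigma>; fb = f_bar T A B \<sigma> G;
          M = Hb ** transpose (A_til A) ** matrix_inv Hb
      in \<forall>t\<in>{0..T}. (M ** Nb + Hb) *v q = - (M *v fb t) + tderiv T fb t - Hb *v vecc (G t))"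

definition Y_formula ::
    "real \<Rightarrow> real^'n^'n \<Rightarrow> real^'m^'n \<Rightarrow> ('n \<times> 'n \<Rightarrow> nat \<times> ('n \<times> 'm)) \<Rightarrow>
     (real \<Rightarrow> real^'n^'n) \<Rightarrow> real^'n^'n \<Rightarrow> (real \<Rightarrow> real^'n^'n) \<Rightarrow> bool" where
  "Y_formula T A B \<sigma> G Q Y \<longleftrightarrow>
     (\<forall>t\<in>{0..T}. H_bar A B \<sigma> *v vecc (Y t) + N_bar A B \<sigma> *v vecc Q + f_bar T A B \<sigma> G t = 0)"

text \<open>Functions on \<open>[0,T]\<close> are total functions, so uniqueness is uniqueness of the values on \<open>[0,T]\<close>.\<close>

definition unique_solution_given_by_formula ::
    "real \<Rightarrow> real^'n^'n \<Rightarrow> real^'m^'n \<Rightarrow> ('n \<times> 'n \<Rightarrow> nat \<times> ('n \<times> 'm)) \<Rightarrow>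
     (real \<Rightarrow> real^'n^'n) \<Rightarrow> real^'n^'n \<Rightarrow> bool" where
  "unique_solution_given_by_formula T A B \<sigma> G Q \<longleftrightarrow>
     (\<exists>Y. is_solution T A B G Q Y) \<and>
     (\<forall>Y. is_solution T A B G Q Y \<longleftrightarrow> Y_formula T A B \<sigma> G Q Y) \<and>
     (\<forall>Y Y'. is_solution T A B G Q Y \<longrightarrow> is_solution T A B G Q Y' \<longrightarrow> (\<forall>t\<in>{0..T}. Y t = Y' t))"

end

theory Submission
  imports Defs
begin

text \<open>
  Differentiating the constraint \<open>B_til\<^sup>T vec(Y) = 0\<close> repeatedly along the differential equation
  yields, block by block, \<open>H vec(Y) + N vec(Q) + f = 0\<close>. A choice of \<open>n\<^sup>2\<close> independent rows
  makes this an explicit formula for \<open>vec(Y)\<close>, and substituting it into the differential equation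
  gives the equation for \<open>q\<^sub>v\<close>. Conversely, the formula defines a curve which solves the
  differential equation by the equation for \<open>q\<^sub>v\<close> and satisfies the constraint because the latter
  is the top block of the formula.

  That \<open>H\<close> has full column rank follows from controllability: a common kernel vector \<open>vec(Y)\<close> of
  the blocks satisfies \<open>B\<^sup>T L\<^sup>k(Y) = 0\<close> for \<open>L(X) = - (A\<^sup>T X + X A)\<close>, hence inductively
  \<open>B\<^sup>T (A\<^sup>T)\<^sup>k Y = 0\<close>, and then the columns of \<open>Y\<close> vanish by Kalman's criterion.
\<close>

subsection \<open>Controllability\<close>

lemma mat_pow_commute: "mat_pow M k ** M = M ** mat_pow M k"
  by (induction k) (simp_all add: matrix_mul_assoc [symmetric])

lemma mat_pow_Suc_vector: "mat_pow M (Suc k) *v v = M *v (mat_pow M k *v v)"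
  by (simp add: matrix_vector_mul_assoc)

text \<open>Stands in for Cayley-Hamilton: some power with index at most \<open>CARD('n)\<close>
  depends on its predecessors, and the span of these is then invariant under
  \<open>M\<close>.\<close>

lemma mat_pow_mem_span_lessThan_dim:
  fixes M :: "real^'n^'n"
  shows "mat_pow M j *v v \<in> span ((\<lambda>i. mat_pow M i *v v) ` {..<CARD('n)})"
proof -
  define w where "w i = mat_pow M i *v v" for i
  have w_Suc: "w (Suc i) = M *v w i" for i
    unfolding w_def by (rule mat_pow_Suc_vector)
  \<comment> \<open>Otherwise every new vector would raise the dimension, up to
    \<open>CARD('n) + 1\<close>.\<close>
  have "\<exists>k\<le>CARD('n). w k \<in> span (w ` {..<k})"
  proof (rule ccontr)
    assume *: "\<not> ?thesis"
    have "k \<le> Suc CARD('n) \<Longrightarrow> dim (w ` {..<k}) = k" for k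
    proof (induction k)
      case (Suc k)
      then show ?case
        using * by (simp add: lessThan_Suc dim_insert)
    qed simp
    then have "dim (w ` {..<Suc CARD('n)}) = Suc CARD('n)" by blast
    then show False
      using dim_subset_UNIV_cart [of "w ` {..<Suc CARD('n)}"] by simp
  qed
  then obtain k where k: "k \<le> CARD('n)" "w k \<in> span (w ` {..<k})" by blast
  \<comment> \<open>\<open>M\<close> shifts the generators by one; only the last image
    \<open>w k\<close> is new, and it lies in the span by choice of \<open>k\<close>.\<close>
  have step: "M *v x \<in> span (w ` {..<k})" if "x \<in> span (w ` {..<k})" for x
  proof -
    have "M *v x \<in> span ((*v) M ` (w ` {..<k}))"
      using that linear_span_image [OF matrix_vector_mul_linear, of M] by blast
    moreover have "(*v) M ` (w ` {..<k}) \<subseteq> span (w ` {..<k})"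
    proof clarify
      fix i assume "i < k"
      then show "M *v w i \<in> span (w ` {..<k})"
        using k(2) by (cases "Suc i = k") (auto simp flip: w_Suc intro: span_base)
    qed
    ultimately show ?thesis
      by (meson span_minimal subspace_span subsetD)
  qed
  \<comment> \<open>For \<open>k = 0\<close> the span is that of the empty set, and the choice of
    \<open>k\<close> says \<open>w 0 = 0\<close>.\<close>
  have "w 0 \<in> span (w ` {..<k})"
    using k(2) by (cases "k = 0") (auto intro: span_base)
  then have "w j \<in> span (w ` {..<k})"
    by (induction j) (simp_all add: w_Suc step)
  moreover have "span (w ` {..<k}) \<subseteq> span (w ` {..<CARD('n)})"
    using k(1) by (intro span_mono image_mono) auto
  ultimately show ?thesis by (auto simp: w_def)
qed

text \<open>The kernel of \<open>C\<close> is a subspace, so the first \<open>CARD('n)\<close>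
  vectors decide. This extends Kalman's finitely many conditions to all powers, as the Taylor
  argument requires.\<close>

lemma mat_pow_annihilated_of_lessThan_dim:
  fixes M :: "real^'n^'n" and C :: "real^'n^'m"
  assumes "\<And>k. k < CARD('n) \<Longrightarrow> C *v (mat_pow M k *v v) = 0"
  shows "C *v (mat_pow M j *v v) = 0"
proof -
  have "span ((\<lambda>i. mat_pow M i *v v) ` {..<CARD('n)}) \<subseteq> {x. C *v x = 0}"
    using assms by (intro span_minimal linear_subspace_kernel) auto
  then show ?thesis
    using mat_pow_mem_span_lessThan_dim by blast
qed

text \<open>
  If \<open>B\<^sup>T (A\<^sup>T)\<^sup>k v\<close> vanishes for all \<open>k\<close>, the functions \<open>h\<^sub>k t = ((A\<^sup>T)\<^sup>k v) \<bullet> x t\<close> along any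
  trajectory satisfy \<open>h\<^sub>k' = h\<^sub>k\<^sub>+\<^sub>1\<close>. Steering \<open>0\<close> to \<open>v\<close>, Taylor's bound for \<open>h\<^sub>0\<close> forces
  \<open>v \<bullet> v = 0\<close>.
\<close>

lemma controllable_imp_transpose_observable:
  fixes A :: "real^'n^'n" and B :: "real^'m^'n"
  assumes "controllable A B"
    and "\<And>k. k < CARD('n) \<Longrightarrow> transpose B *v (mat_pow (transpose A) k *v v) = 0"
  shows "v = 0"
proof -
  define w where "w k = mat_pow (transpose A) k *v v" for k
  have w_Suc: "w (Suc k) = transpose A *v w k" for k
    unfolding w_def by (rule mat_pow_Suc_vector)
  have Bw: "transpose B *v w k = 0" for k
    unfolding w_def by (rule mat_pow_annihilated_of_lessThan_dim [OF assms(2)])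
  obtain \<tau> u x where \<tau>: "\<tau> > 0"
    and x: "\<And>t. t \<in> {0..\<tau>} \<Longrightarrow>
        (x has_vector_derivative (A *v x t + B *v u t)) (at t within {0..\<tau>})"
    and x0: "x 0 = 0" and x1: "x \<tau> = v"
    using assms(1) unfolding controllable_def by metis
  define h where "h k t = w k \<bullet> x t" for k t
  have h_deriv: "(h k has_field_derivative h (Suc k) t) (at t within {0..\<tau>})"
    if t: "t \<in> {0..\<tau>}" for k t
  proof -
    have "(h k has_vector_derivative w k \<bullet> (A *v x t + B *v u t)) (at t within {0..\<tau>})"
      unfolding h_def
      by (rule bounded_linear.has_vector_derivative [OF bounded_linear_inner_right x [OF t]])
    moreover have "w k \<bullet> (A *v x t + B *v u t) = h (Suc k) t"
      using Bw [of k] by (simp add: h_def w_Suc inner_add_right flip: dot_lmul_matrix)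
    ultimately show ?thesis
      by (simp add: has_real_derivative_iff_has_vector_derivative)
  qed
  have "continuous_on {0..\<tau>} x"
    using x by (meson continuous_on_eq_continuous_within has_vector_derivative_continuous)
  then have "bounded (x ` {0..\<tau>})"
    by (intro compact_imp_bounded compact_continuous_image) auto
  then obtain R where R: "\<And>t. t \<in> {0..\<tau>} \<Longrightarrow> norm (x t) \<le> R"
    unfolding bounded_iff by blast
  have R0: "0 \<le> R"
    using R [of 0] \<tau> by (simp add: x0)
  \<comment> \<open>With the operator norm, the bounds on all derivatives grow at most geometrically
    in \<open>k\<close>, so the factorial in the Taylor remainder wins.\<close>
  define c where "c = onorm ((*v) (transpose A))"
  have c0: "0 \<le> c"
    unfolding c_def by (rule onorm_pos_le [OF matrix_vector_mul_bounded_linear])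
  have w_bound: "norm (w k) \<le> c ^ k * norm v" for k
  proof (induction k)
    case (Suc k)
    have "norm (w (Suc k)) \<le> c * norm (w k)"
      unfolding w_Suc c_def by (rule onorm [OF matrix_vector_mul_bounded_linear])
    also have "\<dots> \<le> c * (c ^ k * norm v)"
      by (rule mult_left_mono [OF Suc c0])
    finally show ?case by (simp add: mult.assoc)
  qed (simp add: w_def)
  have h_bound: "norm (h k t) \<le> c ^ k * norm v * R" if "t \<in> {0..\<tau>}" for k t
  proof -
    have "norm (h k t) \<le> norm (w k) * norm (x t)"
      unfolding h_def real_norm_def by (rule Cauchy_Schwarz_ineq2)
    also have "\<dots> \<le> c ^ k * norm v * R"
      using w_bound R [OF that] c0 by (intro mult_mono) auto
    finally show ?thesis .
  qed
  \<comment> \<open>One factor \<open>c * \<tau>\<close> of the remainder goes into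
    \<open>K\<close>, which leaves a term of the exponential series.\<close>
  define K where "K = norm v * R * c * \<tau>"
  have taylor: "norm (h 0 \<tau>) \<le> K * (inverse (fact n) * (c * \<tau>) ^ n)" for n
  proof -
    have "norm (h 0 \<tau> - (\<Sum>i\<le>n. h i 0 * (\<tau> - 0) ^ i / fact i))
        \<le> (c ^ Suc n * norm v * R) * norm (\<tau> - 0) ^ Suc n / fact n"
      by (rule field_Taylor [of "{0..\<tau>}"]) (use \<tau> in \<open>auto intro: h_deriv h_bound [unfolded real_norm_def] simp del: power_Suc\<close>)
    moreover have "h i 0 = 0" for i
      by (simp add: h_def x0)
    ultimately show ?thesis
      using \<tau> by (simp add: K_def power_mult_distrib field_simps)
  qed
  have "(\<lambda>n. K * (inverse (fact n) * (c * \<tau>) ^ n)) \<longlonglongrightarrow> K * 0"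
    by (intro tendsto_mult_left summable_LIMSEQ_zero summable_exp)
  then have "norm (h 0 \<tau>) \<le> K * 0"
    by (rule Lim_bounded2) (use taylor in blast)
  then show ?thesis
    by (simp add: h_def w_def x1 dot_square_norm)
qed

subsection \<open>Vectorisation\<close>

lemma matrix_vector_mult_uminus: "(- M) *v x = - (M *v (x :: 'a::ring_1^'n))"
  using matrix_vector_mult_diff_rdistrib [of 0 M x] by simp

lemma transpose_minus: "transpose (- M) = - transpose (M :: 'a::group_add^'n^'m)"
  by (simp add: transpose_def vec_eq_iff)

lemma transpose_diff: "transpose (M - N) = transpose M - transpose (N :: 'a::group_add^'n^'m)"
  by (simp add: transpose_def vec_eq_iff)

lemma transpose_kron: "transpose (kron M N) = kron (transpose M) (transpose N)"
  by (simp add: kron_def transpose_def vec_eq_iff)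

text \<open>Splitting the sum over pairs into sums over columns and rows of \<open>X\<close> yields
  the entries of the triple product. The rule trades Kronecker products for ordinary matrix
  products.\<close>

lemma kron_mult_vecc:
  fixes M :: "real^'b^'a" and N :: "real^'d^'c" and X :: "real^'b^'d"
  shows "kron M N *v vecc X = vecc (N ** X ** transpose M)"
proof -
  have "(kron M N *v vecc X) $ (i, j) = vecc (N ** X ** transpose M) $ (i, j)" for i j
  proof -
    have "(kron M N *v vecc X) $ (i, j) = (\<Sum>(b, d)\<in>UNIV \<times> UNIV. M $ i $ b * N $ j $ d * X $ d $ b)"
      by (simp add: matrix_vector_mult_def kron_def vecc_def case_prod_beta)
    also have "\<dots> = (\<Sum>b\<in>UNIV. \<Sum>d\<in>UNIV. M $ i $ b * N $ j $ d * X $ d $ b)"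
      by (rule sum.cartesian_product [symmetric])
    also have "\<dots> = vecc (N ** X ** transpose M) $ (i, j)"
      by (simp add: matrix_matrix_mult_def transpose_def vecc_def sum_distrib_left sum_distrib_right
          mult_ac)
    finally show ?thesis .
  qed
  then show ?thesis by (simp add: vec_eq_iff)
qed

lemma vecc_unvecc [simp]: "vecc (\<chi> i j. y $ (j, i)) = y"
  by (simp add: vecc_def vec_eq_iff)

lemma vecc_inject: "vecc X = vecc Y \<longleftrightarrow> X = Y"
  by (auto simp: vecc_def vec_eq_iff)

lemma vecc_zero [simp]: "vecc 0 = 0"
  by (simp add: vecc_def vec_eq_iff)

lemma vecc_minus: "vecc (- X) = - vecc X"
  by (simp add: vecc_def vec_eq_iff)

lemma vecc_add: "vecc (X + Y) = vecc X + vecc Y"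
  by (simp add: vecc_def vec_eq_iff)

lemma bounded_linear_vecc: "bounded_linear (vecc :: real^'b^'a \<Rightarrow> _)"
  by (rule linear_conv_bounded_linear [THEN iffD1]) (auto intro!: linearI simp: vecc_def vec_eq_iff)

lemma bounded_linear_unvecc:
  "bounded_linear (\<lambda>y :: real^('b \<times> 'a). (\<chi> i j. y $ (j, i)) :: real^'b^'a)"
  by (rule linear_conv_bounded_linear [THEN iffD1]) (auto intro!: linearI simp: vec_eq_iff)

lemma B_til_vecc: "transpose (B_til B) *v vecc Y = vecc (transpose B ** Y)"
  by (simp only: B_til_def transpose_kron kron_mult_vecc transpose_mat transpose_transpose
      matrix_mul_rid)

lemma A_til_vecc: "transpose (A_til A) *v vecc Y = - vecc (transpose A ** Y + Y ** A)"
  by (simp only: A_til_def transpose_kron transpose_minus transpose_diff kron_mult_vecc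
      transpose_mat transpose_transpose matrix_mul_rid matrix_mul_lid matrix_vector_mult_diff_rdistrib
      matrix_vector_mult_uminus vecc_add) simp

subsection \<open>Rows of the observability matrix\<close>

lemma matrix_matrix_mult_uminus: "M ** (- X) = - (M ** (X :: 'a::ring_1^'n^'k))"
  by (simp add: matrix_matrix_mult_def vec_eq_iff sum_negf)

text \<open>Induction on \<open>k\<close> for all \<open>Y\<close> at once: the hypotheses for
  \<open>Y\<close>, shifted by one, are those for \<open>L Y\<close>. So
  \<open>C ** mat_pow M i\<close> kills both \<open>Y\<close> and \<open>L Y\<close>, and expanding
  \<open>L Y\<close> leaves only the next power.\<close>

lemma Sylvester_kernel_imp:
  fixes M :: "real^'n^'n" and A :: "real^'n^'n" and C :: "real^'n^'m"
  defines "L \<equiv> \<lambda>X. - (M ** X + X ** A)"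
  assumes "\<And>j. j < k \<Longrightarrow> C ** (L ^^ j) Y = 0" and "j < k"
  shows "C ** mat_pow M j ** Y = 0"
  using assms(2,3)
proof (induction k arbitrary: Y j)
  case (Suc k)
  show ?case
  proof (cases "j < k")
    case True
    then show ?thesis
      using Suc by simp
  next
    case False
    show ?thesis
    proof (cases k)
      case 0
      then show ?thesis
        using Suc.prems(1) [of 0] Suc.prems(2) by simp
    next
      case (Suc i)
      with False Suc.prems(2) have j: "j = Suc i" by simp
      have "C ** mat_pow M i ** L Y = 0"
        using Suc.prems(1) [of "Suc _"] Suc by (intro Suc.IH) (simp_all add: funpow_swap1)
      moreover have "C ** mat_pow M i ** Y = 0"
        using Suc.prems(1) Suc by (intro Suc.IH) simp_all
      moreover have "C ** mat_pow M i ** L Y =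
          - (C ** mat_pow M (Suc i) ** Y + C ** mat_pow M i ** Y ** A)"
        by (simp only: L_def matrix_matrix_mult_uminus matrix_add_ldistrib matrix_mul_assoc
            mat_pow.simps(2) mat_pow_commute [symmetric])
      ultimately show ?thesis
        by (simp add: j)
    qed
  qed
qed simp

text \<open>Full column rank of \<open>H\<close>, phrased through the blocks so that no stacked
  matrix has to be formed.\<close>

lemma H_block_common_kernel:
  fixes A :: "real^'n^'n" and B :: "real^'m^'n"
  assumes "controllable A B" and "\<And>k. k < CARD('n) \<Longrightarrow> H_block A B k *v y = 0"
  shows "y = 0"
proof -
  define Y :: "real^'n^'n" where "Y = (\<chi> i j. y $ (j, i))"
  have y: "y = vecc Y"
    by (simp add: Y_def)
  define L where "L X = - (transpose A ** X + X ** A)" for X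
  have pow: "mat_pow (transpose (A_til A)) k *v vecc Y = vecc ((L ^^ k) Y)" for k
  proof (induction k)
    case (Suc k)
    show ?case
      unfolding mat_pow_Suc_vector Suc A_til_vecc by (simp only: funpow.simps o_apply L_def [of "(L ^^ k) Y"] vecc_minus)
  qed simp
  have "transpose B ** (L ^^ k) Y = 0" if "k < CARD('n)" for k
  proof -
    have "vecc (transpose B ** (L ^^ k) Y) = H_block A B k *v y"
      unfolding H_block_def y
      by (simp only: B_til_vecc [symmetric] pow [symmetric] matrix_vector_mul_assoc)
    then have "vecc (transpose B ** (L ^^ k) Y) = vecc 0"
      using assms(2) [OF that] by simp
    then show ?thesis
      by (simp only: vecc_inject)
  qed
  then have *: "transpose B ** mat_pow (transpose A) k ** Y = 0" if "k < CARD('n)" for k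
    using that unfolding L_def by (intro Sylvester_kernel_imp) auto
  have "Y *v e = 0" for e
  proof (rule controllable_imp_transpose_observable [OF assms(1)])
    fix k assume "k < CARD('n)"
    then have "(transpose B ** mat_pow (transpose A) k ** Y) *v e = 0"
      by (simp add: *)
    then show "transpose B *v (mat_pow (transpose A) k *v (Y *v e)) = 0"
      by (simp only: matrix_vector_mul_assoc matrix_mul_assoc)
  qed
  then have "Y = 0"
    by (simp add: matrix_eq)
  then show ?thesis
    by (simp add: y)
qed

text \<open>A nonzero vector orthogonal to all rows would lie in the common kernel of the
  blocks.\<close>

lemma span_H_rows:
  fixes A :: "real^'n^'n" and B :: "real^'m^'n"
  assumes "controllable A B"
  shows "span (H_row A B ` {s. fst s < CARD('n)}) = UNIV"
proof (rule ccontr)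
  assume "\<not> ?thesis"
  then obtain y where y: "y \<noteq> 0"
    "\<And>x. x \<in> span (H_row A B ` {s. fst s < CARD('n)}) \<Longrightarrow> y \<bullet> x = 0"
    using span_not_UNIV_orthogonal by blast
  have "H_block A B k *v y = 0" if "k < CARD('n)" for k
  proof -
    have "y \<bullet> (H_block A B k $ r) = 0" for r
      using that by (intro y(2) span_base image_eqI [of _ _ "(k, r)"]) (auto simp: H_row_def)
    then show ?thesis
      by (simp add: vec_eq_iff matrix_vector_mul_component inner_commute)
  qed
  then show False
    using H_block_common_kernel [OF assms] y(1) by blast
qed

text \<open>Independence of the set of rows does not see repeated rows, hence the separate
  injectivity. Both together say that the row space has as many basis vectors as there are row
  indices.\<close>

lemma rank_eq_card_rows_iff:
  fixes M :: "real^'n^'m"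
  shows "rank M = CARD('m) \<longleftrightarrow> inj (\<lambda>i. M $ i) \<and> independent (range (\<lambda>i. M $ i))"
proof -
  have rows: "rows M = range (\<lambda>i. M $ i)"
    by (auto simp: rows_def row_def)
  show ?thesis
  proof
    assume rank: "rank M = CARD('m)"
    then have dim: "dim (range (\<lambda>i. M $ i)) = CARD('m)"
      by (simp add: row_rank_def rows)
    then have card: "card (range (\<lambda>i. M $ i)) = CARD('m)"
      by (metis card_image_le dim_le_card' finite finite_imageI le_antisym)
    then have "inj (\<lambda>i. M $ i)"
      by (intro eq_card_imp_inj_on) auto
    moreover have "independent (range (\<lambda>i. M $ i))"
      by (rule card_le_dim_spanning [OF order_refl span_superset]) (simp_all add: dim card)
    ultimately show "inj (\<lambda>i. M $ i) \<and> independent (range (\<lambda>i. M $ i))" ..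
  next
    assume "inj (\<lambda>i. M $ i) \<and> independent (range (\<lambda>i. M $ i))"
    then show "rank M = CARD('m)"
      by (simp add: row_rank_def rows dim_eq_card_independent card_image)
  qed
qed

text \<open>In matrix form \<open>B_til B\<close> is left multiplication by \<open>B\<close>, which
  is injective for \<open>B\<close> of full column rank. It makes the rows of the top block of
  \<open>H\<close> independent, so that all of them can be chosen.\<close>

lemma rank_transpose_B_til:
  fixes B :: "real^'m^'n"
  assumes "rank B = CARD('m)"
  shows "rank (transpose (B_til B)) = CARD('n \<times> 'm)"
proof -
  have inj: "inj ((*v) B)"
    using assms full_rank_injective by blast
  have "inj ((*v) (B_til B))"
  proof (rule injI)
    fix x y :: "real^('n \<times> 'm)"
    assume *: "B_til B *v x = B_til B *v y"
    obtain X Y :: "real^'n^'m" where XY: "x = vecc X" "y = vecc Y"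
      by (rule that [OF vecc_unvecc [symmetric] vecc_unvecc [symmetric]])
    have "B ** X = B ** Y"
      using * by (simp add: XY B_til_def kron_mult_vecc vecc_inject)
    then have "B *v (X *v e) = B *v (Y *v e)" for e
      by (simp add: matrix_vector_mul_assoc)
    then have "X = Y"
      using inj by (simp add: matrix_eq inj_eq)
    then show "x = y"
      by (simp add: XY)
  qed
  then show ?thesis
    unfolding rank_transpose by (rule full_rank_injective [THEN iffD2])
qed

text \<open>The independent rows of the top block extend, within the rows of \<open>H\<close>, to a
  basis of the whole space, which has \<open>CARD('n \<times> 'n)\<close> elements.\<close>

lemma exists_row_choice:
  fixes A :: "real^'n^'n" and B :: "real^'m^'n"
  assumes "controllable A B" "rank B = CARD('m)"
  shows "\<exists>\<sigma>. row_choice A B \<sigma> \<and> contains_top_block \<sigma>"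
proof -
  define S :: "(nat \<times> ('n \<times> 'm)) set" where "S = {s. fst s < CARD('n)}"
  define R where "R r = H_row A B (0, r)" for r
  have R: "R = (\<lambda>r. transpose (B_til B) $ r)"
    by (auto simp: R_def H_row_def H_block_def)
  have inj_R: "inj R" and indep_R: "independent (range R)"
    using rank_transpose_B_til [OF assms(2)] unfolding R rank_eq_card_rows_iff by blast+
  have "range R \<subseteq> H_row A B ` S"
    by (auto simp: R_def S_def)
  then obtain V where V: "range R \<subseteq> V" "V \<subseteq> H_row A B ` S" "independent V"
      "H_row A B ` S \<subseteq> span V"
    using maximal_independent_subset_extend [OF _ indep_R] by metis
  have "span V = UNIV"
    using V(4) span_minimal [OF V(4) subspace_span] span_H_rows [OF assms(1)]
    by (auto simp: S_def)
  then have card: "card V = CARD('n \<times> 'n)"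
    using dim_span_eq_card_independent [OF V(3)] by (simp add: dim_UNIV)
  then obtain h :: "'n \<times> 'n \<Rightarrow> _" where h: "bij_betw h UNIV V"
    using finite_same_card_bij [of "UNIV :: ('n \<times> 'n) set" V] finiteI_independent [OF V(3)] by auto
  \<comment> \<open>A top row may recur in a later block, so vectors in \<open>range R\<close> are
    explicitly given their address in block \<open>0\<close>.\<close>
  define s where "s v = (if v \<in> range R then (0, inv R v) else SOME s. s \<in> S \<and> H_row A B s = v)"
    for v
  have s: "s v \<in> S \<and> H_row A B (s v) = v" if "v \<in> V" for v
  proof (cases "v \<in> range R")
    case True
    then have "H_row A B (0, inv R v) = v"
      by (metis R_def f_inv_into_f)
    with True show ?thesis
      by (simp add: s_def S_def)
  next
    case False
    have "\<exists>s. s \<in> S \<and> H_row A B s = v"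
      using that V(2) by blast
    then show ?thesis
      unfolding s_def if_not_P [OF False] by (rule someI_ex)
  qed
  have hV: "h p \<in> V" for p
    using h by (auto simp: bij_betw_def)
  have "row_choice A B (\<lambda>p. s (h p))"
    using h V(3) s [OF hV] by (auto simp: row_choice_def bij_betw_def S_def)
  moreover have "(0, r) \<in> range (\<lambda>p. s (h p))" for r
  proof -
    obtain p where "h p = R r"
      using h V(1) by (metis bij_betw_def imageE rangeI subsetD)
    then have "s (h p) = (0, r)"
      using inj_R by (simp add: s_def)
    then show ?thesis
      by (metis rangeI)
  qed
  ultimately show ?thesis
    unfolding contains_top_block_def by blast
qed

lemma H_bar_invertible:
  fixes A :: "real^'n^'n"
  assumes "row_choice A B \<sigma>"
  shows "invertible (H_bar A B \<sigma>)"
proof -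
  have "rank (H_bar A B \<sigma>) = CARD('n \<times> 'n)"
    using assms by (simp only: rank_eq_card_rows_iff) (simp add: row_choice_def H_bar_def)
  then show ?thesis
    by (simp only: full_rank_injective invertible_left_inverse matrix_left_invertible_injective)
qed

lemma matrix_inv_mult_vector:
  fixes M :: "real^'n^'n"
  assumes "invertible M"
  shows "M *v (matrix_inv M *v x) = x" and "matrix_inv M *v (M *v x) = x"
proof -
  have "M ** matrix_inv M = mat 1 \<and> matrix_inv M ** M = mat 1"
    using assms unfolding invertible_def matrix_inv_def by (rule someI_ex)
  then show "M *v (matrix_inv M *v x) = x" and "matrix_inv M *v (M *v x) = x"
    by (simp_all only: matrix_vector_mul_assoc matrix_vector_mul_lid)
qed

subsection \<open>The constrained differential equation\<close>

lemma tdifferentiable_has_vector_derivative: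
  assumes "tdifferentiable T F" "t \<in> {0..T}"
  shows "(F has_vector_derivative tderiv T F t) (at t within {0..T})"
  using assms unfolding tdifferentiable_def tderiv_def
  by (simp add: vector_derivative_works [symmetric])

lemma tderiv_eqI:
  fixes F :: "real \<Rightarrow> 'v::euclidean_space"
  assumes "T > 0" "t \<in> {0..T}" "(F has_vector_derivative D) (at t within {0..T})"
  shows "tderiv T F t = D"
  unfolding tderiv_def by (rule vector_derivative_within_closed_interval [OF assms])

text \<open>Differentiation raises each order of \<open>G\<close> by one, which gives the next block
  without its \<open>i = 0\<close> term. Block \<open>k\<close> involves only orders below
  \<open>k\<close>, so \<open>CARD('n) - 1\<close> differentiations of \<open>G\<close>
  suffice.\<close>

lemma f_block_has_vector_derivative:
  fixes A :: "real^'n^'n" and B :: "real^'m^'n"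
  assumes G: "times_tdifferentiable (CARD('n) - 1) T G" and "k < CARD('n)" and t: "t \<in> {0..T}"
  shows "(f_block T A B G k has_vector_derivative
           f_block T A B G (Suc k) t + H_block A B k *v vecc (G t)) (at t within {0..T})"
proof -
  have *: "((\<lambda>t. M *v vecc ((tderiv T ^^ i) G t)) has_vector_derivative
        M *v vecc ((tderiv T ^^ Suc i) G t)) (at t within {0..T})"
    if "i < k" for i and M :: "real^('n \<times> 'n)^('n \<times> 'm)"
  proof -
    have "tdifferentiable T ((tderiv T ^^ i) G)"
      using G that \<open>k < CARD('n)\<close> by (simp add: times_tdifferentiable_def)
    from tdifferentiable_has_vector_derivative [OF this t] show ?thesis
      by (auto intro!: bounded_linear.has_vector_derivative [OF matrix_vector_mul_bounded_linear]
          bounded_linear.has_vector_derivative [OF bounded_linear_vecc])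
  qed
  have "(f_block T A B G k has_vector_derivative
      - (\<Sum>i<k. H_block A B (k - 1 - i) *v vecc ((tderiv T ^^ Suc i) G t))) (at t within {0..T})"
    unfolding f_block_def [abs_def] H_block_def
    by (intro has_vector_derivative_minus has_vector_derivative_sum *) auto
  moreover have "f_block T A B G (Suc k) t = - (H_block A B k *v vecc (G t)) -
      (\<Sum>i<k. H_block A B (k - 1 - i) *v vecc ((tderiv T ^^ Suc i) G t))"
    unfolding f_block_def H_block_def [symmetric] by (subst sum.lessThan_Suc_shift) simp
  ultimately show ?thesis by simp
qed

lemma f_bar_tdifferentiable:
  fixes A :: "real^'n^'n" and B :: "real^'m^'n"
  assumes G: "times_tdifferentiable (CARD('n) - 1) T G" and \<sigma>: "row_choice A B \<sigma>"
  shows "tdifferentiable T (f_bar T A B \<sigma> G)"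
  unfolding tdifferentiable_def
proof
  fix t assume t: "t \<in> {0..T}"
  have "(\<lambda>t. f_bar T A B \<sigma> G t $ p) differentiable (at t within {0..T})" for p
  proof -
    have "((\<lambda>t. f_block T A B G (fst (\<sigma> p)) t $ snd (\<sigma> p)) has_vector_derivative
        (f_block T A B G (Suc (fst (\<sigma> p))) t + H_block A B (fst (\<sigma> p)) *v vecc (G t)) $ snd (\<sigma> p))
        (at t within {0..T})"
      using \<sigma> unfolding row_choice_def
      by (intro bounded_linear.has_vector_derivative [OF bounded_linear_vec_nth]
          f_block_has_vector_derivative [OF G _ t]) blast
    then show ?thesis
      by (auto simp: f_bar_def differentiable_def has_vector_derivative_def)
  qed
  then show "f_bar T A B \<sigma> G differentiable (at t within {0..T})"
    by (subst differentiable_componentwise_within) (auto simp: Basis_vec_def inner_axis)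
qed

text \<open>Block \<open>0\<close> is the constraint. Differentiating block \<open>k\<close> and
  inserting the differential equation gives block \<open>Suc k\<close>: \<open>N_block\<close> takes
  up the \<open>Q\<close> term, and the two terms in \<open>vecc (G t)\<close> cancel.\<close>

lemma solution_block_identity:
  fixes A :: "real^'n^'n" and B :: "real^'m^'n"
  assumes "T > 0" and G: "times_tdifferentiable (CARD('n) - 1) T G"
    and sol: "is_solution T A B G Q Y" and "k < CARD('n)" and "t \<in> {0..T}"
  shows "H_block A B k *v vecc (Y t) + N_block A B k *v vecc Q + f_block T A B G k t = 0"
  using assms(4,5)
proof (induction k arbitrary: t)
  case 0
  then show ?case
    using sol by (simp add: is_solution_def H_block_def N_block_def f_block_def
        del: transpose_matrix_vector)
next
  case (Suc k)
  note t = \<open>t \<in> {0..T}\<close>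
  let ?e = "\<lambda>t. H_block A B k *v vecc (Y t) + N_block A B k *v vecc Q + f_block T A B G k t"
  let ?D = "H_block A B k *v vecc (tderiv T Y t) + 0 +
      (f_block T A B G (Suc k) t + H_block A B k *v vecc (G t))"
  have "tdifferentiable T Y"
    using sol by (simp add: is_solution_def)
  from tdifferentiable_has_vector_derivative [OF this t]
  have D: "(?e has_vector_derivative ?D) (at t within {0..T})"
    by (intro has_vector_derivative_add has_vector_derivative_const
        bounded_linear.has_vector_derivative [OF matrix_vector_mul_bounded_linear]
        bounded_linear.has_vector_derivative [OF bounded_linear_vecc]
        f_block_has_vector_derivative [OF G _ t] Suc_lessD [OF Suc.prems(1)])
  \<comment> \<open>The identity for block \<open>k\<close> holds only on \<open>[0,T]\<close>.
    There \<open>?e\<close> agrees with \<open>0\<close>, and \<open>T > 0\<close> makes the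
    derivative within the interval unique.\<close>
  have "((\<lambda>t. 0) has_vector_derivative ?D) (at t within {0..T})"
    using Suc.IH [OF Suc_lessD [OF Suc.prems(1)]]
    by (intro has_vector_derivative_transform [OF t _ D]) simp
  then have "tderiv T (\<lambda>t. 0) t = ?D"
    by (rule tderiv_eqI [OF \<open>T > 0\<close> t])
  moreover have "tderiv T (\<lambda>t. 0 :: real^('n \<times> 'm)) t = 0"
    by (intro tderiv_eqI [OF \<open>T > 0\<close> t]) simp
  moreover have "H_block A B k *v vecc (tderiv T Y t) = H_block A B (Suc k) *v vecc (Y t)
      + N_block A B (Suc k) *v vecc Q - H_block A B k *v vecc (G t)"
  proof -
    have "vecc (tderiv T Y t) = transpose (A_til A) *v vecc (Y t) - vecc Q - vecc (G t)"
      using sol t unfolding is_solution_def by blast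
    moreover have "H_block A B (Suc k) = H_block A B k ** transpose (A_til A)"
      by (simp add: H_block_def mat_pow_commute flip: matrix_mul_assoc)
    moreover have "N_block A B (Suc k) = - H_block A B k"
      by (simp add: N_block_def H_block_def)
    ultimately show ?thesis
      by (simp only: matrix_vector_mult_diff_distrib matrix_vector_mul_assoc
          matrix_vector_mult_uminus) simp
  qed
  ultimately show ?case by (simp add: add.assoc)
qed

section \<open>The formula for vec(Y)\<close>

lemma solution_imp_Y_formula:
  fixes A :: "real^'n^'n" and B :: "real^'m^'n"
  assumes "T > 0" "times_tdifferentiable (CARD('n) - 1) T G"
    and "is_solution T A B G Q Y" and \<sigma>: "row_choice A B \<sigma>"
  shows "Y_formula T A B \<sigma> G Q Y"
  unfolding Y_formula_def
proof
  fix t assume t: "t \<in> {0..T}"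
  have "(H_bar A B \<sigma> *v vecc (Y t) + N_bar A B \<sigma> *v vecc Q + f_bar T A B \<sigma> G t) $ p = 0" for p
  proof -
    have "fst (\<sigma> p) < CARD('n)"
      using \<sigma> unfolding row_choice_def by blast
    from solution_block_identity [OF assms(1-3) this t]
    have "(H_block A B (fst (\<sigma> p)) *v vecc (Y t) + N_block A B (fst (\<sigma> p)) *v vecc Q
        + f_block T A B G (fst (\<sigma> p)) t) $ snd (\<sigma> p) = 0"
      by simp
    then show ?thesis
      by (simp add: H_bar_def N_bar_def f_bar_def H_row_def matrix_vector_mul_component)
  qed
  then show "H_bar A B \<sigma> *v vecc (Y t) + N_bar A B \<sigma> *v vecc Q + f_bar T A B \<sigma> G t = 0"
    by (simp add: vec_eq_iff)
qed

lemma Y_formula_unique: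
  assumes "row_choice A B \<sigma>" "Y_formula T A B \<sigma> G Q Y" "Y_formula T A B \<sigma> G Q Y'" "t \<in> {0..T}"
  shows "Y t = Y' t"
proof -
  have "H_bar A B \<sigma> *v vecc (Y t) = H_bar A B \<sigma> *v vecc (Y' t)"
    using assms unfolding Y_formula_def by (metis add_right_cancel)
  then show ?thesis
    by (metis H_bar_invertible [OF assms(1)] matrix_inv_mult_vector(2) vecc_inject)
qed

text \<open>Solved for \<open>vecc (Y t)\<close>, the formula depends on time only through
  \<open>f_bar\<close>, so \<open>Y\<close> inherits its differentiability and the
  \<open>N_bar\<close> term drops out of the derivative.\<close>

lemma Y_formula_has_vector_derivative:
  fixes A :: "real^'n^'n" and B :: "real^'m^'n"
  assumes G: "times_tdifferentiable (CARD('n) - 1) T G"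
    and \<sigma>: "row_choice A B \<sigma>" and Y: "Y_formula T A B \<sigma> G Q Y" and t: "t \<in> {0..T}"
  shows "\<exists>D. (Y has_vector_derivative D) (at t within {0..T}) \<and>
           H_bar A B \<sigma> *v vecc D = - tderiv T (f_bar T A B \<sigma> G) t"
proof -
  note inv = matrix_inv_mult_vector [OF H_bar_invertible [OF \<sigma>]]
  let ?unvecc = "\<lambda>y :: real^('n \<times> 'n). (\<chi> i j. y $ (j, i)) :: real^'n^'n"
  let ?Hi = "matrix_inv (H_bar A B \<sigma>)"
  let ?D = "?unvecc (?Hi *v (0 - tderiv T (f_bar T A B \<sigma> G) t))"
  have "((\<lambda>t. ?unvecc (?Hi *v (- (N_bar A B \<sigma> *v vecc Q) - f_bar T A B \<sigma> G t)))
      has_vector_derivative ?D) (at t within {0..T})"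
    by (intro bounded_linear.has_vector_derivative [OF bounded_linear_unvecc]
        bounded_linear.has_vector_derivative [OF matrix_vector_mul_bounded_linear]
        has_vector_derivative_diff has_vector_derivative_const
        tdifferentiable_has_vector_derivative [OF f_bar_tdifferentiable [OF G \<sigma>] t])
  moreover have "Y t = ?unvecc (?Hi *v (- (N_bar A B \<sigma> *v vecc Q) - f_bar T A B \<sigma> G t))"
    if "t \<in> {0..T}" for t
  proof -
    have "H_bar A B \<sigma> *v vecc (Y t) = - (N_bar A B \<sigma> *v vecc Q) - f_bar T A B \<sigma> G t"
      using Y that by (simp add: Y_formula_def algebra_simps eq_neg_iff_add_eq_0)
    then have "vecc (Y t) = ?Hi *v (- (N_bar A B \<sigma> *v vecc Q) - f_bar T A B \<sigma> G t)"
      by (metis inv(2))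
    then show ?thesis
      by (subst vecc_inject [symmetric]) simp
  qed
  ultimately have "(Y has_vector_derivative ?D) (at t within {0..T})"
    by (rule has_vector_derivative_transform [OF t, rotated])
  then show ?thesis
    by (intro exI [of _ ?D]) (simp add: inv)
qed

text \<open>Multiplying by the invertible \<open>H_bar\<close> loses nothing; \<open>H_bar\<close>
  times the derivative of vec(Y) is minus that of \<open>f_bar\<close>, and the formula eliminates
  \<open>Y\<close> from the right-hand side.\<close>

lemma Y_formula_imp_ode_iff_q_equation:
  fixes A :: "real^'n^'n" and B :: "real^'m^'n"
  assumes "T > 0" and G: "times_tdifferentiable (CARD('n) - 1) T G"
    and \<sigma>: "row_choice A B \<sigma>" and Y: "Y_formula T A B \<sigma> G Q Y"
  shows "(\<forall>t\<in>{0..T}. vecc (tderiv T Y t) = transpose (A_til A) *v vecc (Y t) - vecc Q - vecc (G t))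
           \<longleftrightarrow> q_equation T A B \<sigma> G (vecc Q)"
proof -
  define F where "F = transpose (A_til A)"
  define Hb where "Hb = H_bar A B \<sigma>"
  define Nb where "Nb = N_bar A B \<sigma>"
  define fb where "fb = f_bar T A B \<sigma> G"
  have inv: "Hb *v (matrix_inv Hb *v x) = x" "matrix_inv Hb *v (Hb *v x) = x" for x
    unfolding Hb_def by (rule matrix_inv_mult_vector [OF H_bar_invertible [OF \<sigma>]])+
  have "vecc (tderiv T Y t) = F *v vecc (Y t) - vecc Q - vecc (G t) \<longleftrightarrow>
      (Hb ** F ** matrix_inv Hb ** Nb + Hb) *v vecc Q =
        - ((Hb ** F ** matrix_inv Hb) *v fb t) + tderiv T fb t - Hb *v vecc (G t)"
    if t: "t \<in> {0..T}" for t
  proof -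
    obtain D where D: "(Y has_vector_derivative D) (at t within {0..T})"
      "Hb *v vecc D = - tderiv T fb t"
      using Y_formula_has_vector_derivative [OF G \<sigma> Y t] unfolding Hb_def fb_def by blast
    from tderiv_eqI [OF \<open>T > 0\<close> t D(1)] D(2)
    have deriv: "Hb *v vecc (tderiv T Y t) = - tderiv T fb t" by simp
    have "Hb *v vecc (Y t) = - (Nb *v vecc Q) - fb t"
      using Y t by (simp add: Y_formula_def Hb_def Nb_def fb_def algebra_simps eq_neg_iff_add_eq_0)
    then have y: "vecc (Y t) = matrix_inv Hb *v (- (Nb *v vecc Q) - fb t)"
      by (metis inv(2))
    have minus: "M *v (- x) = - (M *v x)" for M :: "real^('n \<times> 'n)^('n \<times> 'n)" and x
      using matrix_vector_mult_diff_distrib [of M 0 x] by simp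
    have "vecc (tderiv T Y t) = F *v vecc (Y t) - vecc Q - vecc (G t) \<longleftrightarrow>
        Hb *v vecc (tderiv T Y t) = Hb *v (F *v vecc (Y t) - vecc Q - vecc (G t))"
      by (metis inv(2))
    also have "\<dots> \<longleftrightarrow> - tderiv T fb t = - (Hb *v (F *v (matrix_inv Hb *v (Nb *v vecc Q))))
        - Hb *v (F *v (matrix_inv Hb *v fb t)) - Hb *v vecc Q - Hb *v vecc (G t)"
      by (simp only: deriv y matrix_vector_mult_diff_distrib minus)
    also have "\<dots> \<longleftrightarrow> (Hb ** F ** matrix_inv Hb ** Nb + Hb) *v vecc Q =
        - ((Hb ** F ** matrix_inv Hb) *v fb t) + tderiv T fb t - Hb *v vecc (G t)"
      by (simp only: matrix_vector_mult_add_rdistrib matrix_vector_mul_assoc [symmetric])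
        (auto simp: algebra_simps)
    finally show ?thesis .
  qed
  then show ?thesis
    by (simp add: q_equation_def Let_def F_def Hb_def Nb_def fb_def del: transpose_matrix_vector)
qed

section \<open>Solvability and uniqueness\<close>

lemma solution_imp_q_equation:
  fixes A :: "real^'n^'n" and B :: "real^'m^'n"
  assumes "T > 0" "times_tdifferentiable (CARD('n) - 1) T G"
    and "row_choice A B \<sigma>" and "is_solution T A B G Q Y"
  shows "q_equation T A B \<sigma> G (vecc Q)"
  using Y_formula_imp_ode_iff_q_equation [OF assms(1-3) solution_imp_Y_formula [OF assms(1,2,4,3)]]
    assms(4) unfolding is_solution_def by blast

lemma q_equation_imp_solution:
  fixes A :: "real^'n^'n" and B :: "real^'m^'n"
  assumes "T > 0" and G: "times_tdifferentiable (CARD('n) - 1) T G"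
    and \<sigma>: "row_choice A B \<sigma>" and top: "contains_top_block \<sigma>"
    and q: "q_equation T A B \<sigma> G (vecc Q)"
  shows "\<exists>Y. is_solution T A B G Q Y"
proof -
  note inv = matrix_inv_mult_vector [OF H_bar_invertible [OF \<sigma>]]
  let ?y = "\<lambda>t. matrix_inv (H_bar A B \<sigma>) *v (- (N_bar A B \<sigma> *v vecc Q) - f_bar T A B \<sigma> G t)"
  define Y :: "real \<Rightarrow> real^'n^'n" where "Y t = (\<chi> i j. ?y t $ (j, i))" for t
  have Y: "Y_formula T A B \<sigma> G Q Y"
    unfolding Y_formula_def Y_def by (simp add: inv)
  have "tdifferentiable T Y"
    using Y_formula_has_vector_derivative [OF G \<sigma> Y]
    by (meson tdifferentiable_def differentiableI_vector)
  moreover have "transpose (B_til B) *v vecc (Y t) = 0" if t: "t \<in> {0..T}" for t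
  proof -
    have "(transpose (B_til B) *v vecc (Y t)) $ r = 0" for r
    proof -
      \<comment> \<open>Block \<open>0\<close> of \<open>N\<close> and \<open>f\<close> is zero, so
        row \<open>p\<close> of the formula is entry \<open>r\<close> of the constraint.\<close>
      obtain p where p: "\<sigma> p = (0, r)"
        using top by (metis contains_top_block_def imageE)
      have "(H_bar A B \<sigma> *v vecc (Y t) + N_bar A B \<sigma> *v vecc Q + f_bar T A B \<sigma> G t) $ p = 0"
        using Y t by (simp add: Y_formula_def)
      then show ?thesis
        by (simp add: H_bar_def N_bar_def f_bar_def H_row_def H_block_def N_block_def f_block_def
            matrix_vector_mul_component p del: transpose_matrix_vector)
    qed
    then show ?thesis
      by (simp add: vec_eq_iff del: transpose_matrix_vector)
  qed
  moreover have "\<forall>t\<in>{0..T}. vecc (tderiv T Y t) =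
      transpose (A_til A) *v vecc (Y t) - vecc Q - vecc (G t)"
    using Y_formula_imp_ode_iff_q_equation [OF assms(1-3) Y] q by blast
  ultimately show ?thesis
    unfolding is_solution_def by blast
qed

text \<open>Derivatives are taken within \<open>[0,T]\<close>, so being a solution depends only on
  the values there, which are all that the formula determines.\<close>

lemma is_solution_cong:
  assumes sol: "is_solution T A B G Q Y" and "T > 0" and eq: "\<And>t. t \<in> {0..T} \<Longrightarrow> Y' t = Y t"
  shows "is_solution T A B G Q Y'"
proof -
  have D: "(Y' has_vector_derivative tderiv T Y t) (at t within {0..T})" if t: "t \<in> {0..T}" for t
  proof (rule has_vector_derivative_transform [OF t eq])
    show "(Y has_vector_derivative tderiv T Y t) (at t within {0..T})"
      using sol t by (intro tdifferentiable_has_vector_derivative) (simp_all add: is_solution_def)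
  qed
  then have "tdifferentiable T Y'"
    by (meson tdifferentiable_def differentiableI_vector)
  moreover have "tderiv T Y' t = tderiv T Y t" if "t \<in> {0..T}" for t
    by (rule tderiv_eqI [OF \<open>T > 0\<close> that D [OF that]])
  ultimately show ?thesis
    using sol eq unfolding is_solution_def by metis
qed

text \<open>Every solution obeys the formula, which fixes the values on \<open>[0,T]\<close>; so any
  function obeying it agrees there with the given solution and is itself one.\<close>

lemma unique_solutionI:
  fixes A :: "real^'n^'n" and B :: "real^'m^'n"
  assumes "T > 0" and G: "times_tdifferentiable (CARD('n) - 1) T G"
    and \<sigma>: "row_choice A B \<sigma>" and sol: "is_solution T A B G Q Y"
  shows "unique_solution_given_by_formula T A B \<sigma> G Q"
proof -
  note formula = solution_imp_Y_formula [OF \<open>T > 0\<close> G _ \<sigma>]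
  have "is_solution T A B G Q Y'" if "Y_formula T A B \<sigma> G Q Y'" for Y'
    using is_solution_cong [OF sol \<open>T > 0\<close>] Y_formula_unique [OF \<sigma> that formula [OF sol]] by blast
  then show ?thesis
    unfolding unique_solution_given_by_formula_def
    using sol formula Y_formula_unique [OF \<sigma>] by blast
qed

theorem theorem10:
  fixes A :: "real^'n^'n" and B :: "real^'m^'n" and K :: "real \<Rightarrow> real^'n^'m" and T :: real
    and G :: "real \<Rightarrow> real^'n^'n"
  assumes "controllable A B"
    and "rank B = CARD('m)"
    and "T > 0"
    and "G = G_of T A B K"
    and "tdifferentiable T (P0 B K)"
    and "times_tdifferentiable (CARD('n) - 1) T G"
  shows "(\<exists>\<sigma>. row_choice A B \<sigma> \<and> contains_top_block \<sigma>) \<and>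
    (\<forall>\<sigma>. row_choice A B \<sigma> \<and> contains_top_block \<sigma> \<longrightarrow>
       ((\<exists>Q Y. is_solution T A B G Q Y) \<longleftrightarrow> (\<exists>q. q_equation T A B \<sigma> G q)) \<and>
       (\<forall>q Q. q_equation T A B \<sigma> G q \<and> vecc Q = q \<longrightarrow>
          unique_solution_given_by_formula T A B \<sigma> G Q)) \<and>
    (\<forall>\<sigma>. row_choice A B \<sigma> \<longrightarrow>
       ((\<exists>Q Y. is_solution T A B G Q Y) \<longrightarrow> (\<exists>q. q_equation T A B \<sigma> G q)) \<and>
       (\<forall>Q. (\<exists>Y. is_solution T A B G Q Y) \<longrightarrow>
          unique_solution_given_by_formula T A B \<sigma> G Q))"
  proof -
  note T = \<open>T > 0\<close> and G = \<open>times_tdifferentiable (CARD('n) - 1) T G\<close>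
  have q_imp: "\<exists>Y. is_solution T A B G Q Y"
    if "row_choice A B \<sigma>" "contains_top_block \<sigma>" "q_equation T A B \<sigma> G q" "vecc Q = q" for \<sigma> q Q
    using q_equation_imp_solution [OF T G that(1,2)] that(3,4) by blast
  have ex: "\<exists>Q Y. is_solution T A B G Q Y"
    if "row_choice A B \<sigma>" "contains_top_block \<sigma>" "q_equation T A B \<sigma> G q" for \<sigma> q
    using q_imp [OF that vecc_unvecc] by blast
  show ?thesis
    using exists_row_choice [OF \<open>controllable A B\<close> \<open>rank B = CARD('m)\<close>] ex q_imp
      solution_imp_q_equation [OF T G] unique_solutionI [OF T G]
    by (intro conjI allI impI iffI; blast)
qed

end
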